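(* Let $G$ be a finite group with a unique conjugacy class of involutions and let $H\leqslant G$ be a subgroup of order $2$. Then there is an extension $E$ of a $2$-group $T$ by $G$ such that all involutions of $E$ lie in $T$.
   Context: An extension $E$ of $T$ by $G$ is a group $E$ with a normal subgroup (identified with) $T$ such that $E/T\cong G$. An involution is an element of order $2$. *)

theory Defs
  imports "HOL-Algebra.Algebra"
begin

definition involutions :: "('a, 'm) monoid_scheme \<Rightarrow> 'a set" where
  "involutions G = {x \<in> carrier G. group.ord G x = 2}"

definition conjugacy_class :: "('a, 'm) monoid_scheme \<Rightarrow> 'a \<Rightarrow> 'a set" where
  "conjugacy_class G x = {g \<otimes>\<^bsub>G\<^esub> x \<otimes>\<^bsub>G\<^esub> inv\<^bsub>G\<^esub> g | g. g \<in> carrier G}"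

text \<open>The unique existence includes that there is at least one involution.\<close>

definition unique_involution_class :: "('a, 'm) monoid_scheme \<Rightarrow> bool" where
  "unique_involution_class G \<longleftrightarrow> (\<exists>!C. \<exists>x \<in> involutions G. C = conjugacy_class G x)"

text \<open>Finite 2-groups: \<^term>\<open>order T\<close> is 0 for infinite \<open>T\<close>, so the condition
  on the order implies finiteness.\<close>

definition two_group :: "('a, 'm) monoid_scheme \<Rightarrow> bool" where
  "two_group T \<longleftrightarrow> group T \<and> (\<exists>n::nat. order T = 2 ^ n)"

text \<open>\<open>T\<close> is identified with a normal subgroup of \<open>E\<close>. The carrier types of \<open>E\<close> and \<open>G\<close>
  are independent: HOL cannot quantify existentially over types, but every finite group has an
  isomorphic copy on a subset of \<^typ>\<open>nat\<close>, so \<open>E :: nat monoid\<close> covers all finite extensions.\<close>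

definition group_extension ::
  "('e, 'm) monoid_scheme \<Rightarrow> 'e set \<Rightarrow> ('a, 'n) monoid_scheme \<Rightarrow> bool" where
  "group_extension E T G \<longleftrightarrow> group E \<and> T \<lhd> E \<and> (E Mod T) \<cong> G"

end

theory Submission
  imports Defs
begin

text \<open>
  Fix an involution \<open>h\<close> of \<open>G\<close>. The cyclic group of order 4, as an extension of \<open>\<langle>h\<rangle>\<close>, gives
  the nonzero class in \<open>H\<^sup>2(\<langle>h\<rangle>, \<int>/2)\<close>; by Shapiro's lemma it comes from a class of \<open>G\<close> with
  coefficients in the coinduced module, and \<open>E\<close> is the extension it defines. Concretely, let \<open>S\<close>
  be a transversal of the cosets \<open>x\<langle>h\<rangle>\<close> with indicator function \<open>s\<close>. On \<open>G \<times> \<int>/2\<close> the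
  permutation \<open>c(x, a) = (xh, a + s(x))\<close> has order 4, and \<open>E\<close> consists of the permutations
  \<open>(x, a) \<mapsto> (gx, a + f(x))\<close> that commute with \<open>c\<close>, that is,
  \<open>f(x) + f(xh) = s(x) + s(gx)\<close>. If such an element squares to 1 but \<open>g \<noteq> 1\<close>, then \<open>g\<close> is
  an involution, so \<open>gk = kh\<close> for some \<open>k\<close>. The second component of the square at \<open>k\<close> is
  \<open>f(k) + f(gk) = f(k) + f(kh) = s(k) + s(kh) = 1\<close>, a contradiction.
\<close>

section \<open>Involutions and transport to the natural numbers\<close>

lemma (in group) ord_eq_2_iff:
  assumes "x \<in> carrier G"
  shows "ord x = 2 \<longleftrightarrow> x \<otimes> x = \<one> \<and> x \<noteq> \<one>"
proof -
  have sq: "x [^] (2::nat) = x \<otimes> x"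
    using assms by (simp add: numeral_2_eq_2)
  show ?thesis
  proof
    assume o: "ord x = 2"
    then show "x \<otimes> x = \<one> \<and> x \<noteq> \<one>"
      using pow_ord_eq_1[OF assms] ord_eq_1[OF assms] sq by simp
  next
    assume a: "x \<otimes> x = \<one> \<and> x \<noteq> \<one>"
    then have "ord x dvd 2" using pow_eq_id[OF assms] sq by simp
    moreover have "ord x \<noteq> 1" using a ord_eq_1[OF assms] by simp
    ultimately show "ord x = 2" using two_is_prime_nat prime_nat_iff by blast
  qed
qed

lemma (in group) image_group_iso:
  assumes "inj_on e (carrier G)"
  shows "group (image_group e G)" and "e \<in> iso G (image_group e G)"
proof -
  show i: "e \<in> iso G (image_group e G)"
    using assms by (auto simp: iso_def hom_def bij_betw_def image_group_def)
  show "group (image_group e G)"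
    using iso_imp_img_group[OF i] by (simp add: image_group_def)
qed

text \<open>The extension may be built on any type as a finite group \<open>K\<close> with
  projection \<open>p\<close>. An injection \<open>e\<close> into \<open>nat\<close> carries
  \<open>K\<close> to \<open>E\<close> and \<open>p\<close> to \<open>q\<close>; \<open>T\<close> is
  the kernel of \<open>q\<close>, and the first isomorphism theorem gives the quotient.\<close>

lemma extension_on_nat:
  assumes "group G" and "group K" and fin: "finite (carrier K)"
    and p: "p \<in> hom K G" and surj: "p ` carrier K = carrier G"
    and card: "card (kernel K G p) = 2 ^ n"
    and inv: "\<And>x. x \<in> carrier K \<Longrightarrow> x \<otimes>\<^bsub>K\<^esub> x = \<one>\<^bsub>K\<^esub> \<Longrightarrow> p x = \<one>\<^bsub>G\<^esub>"
  shows "\<exists>(E :: nat monoid) T.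
           group_extension E T G \<and> two_group (E\<lparr>carrier := T\<rparr>) \<and> involutions E \<subseteq> T"
proof -
  interpret K: group K by fact
  obtain e :: "_ \<Rightarrow> nat" where e: "inj_on e (carrier K)"
    using finite_imp_inj_to_nat_seg[OF fin] by blast
  define E where "E = image_group e K"
  define q where "q = p \<circ> inv_into (carrier K) e"
  have E: "group E" and ei: "e \<in> iso K E"
    unfolding E_def using K.image_group_iso[OF e] by auto
  have carE: "carrier E = e ` carrier K" by (simp add: E_def image_group_carrier)
  have qe: "q (e x) = p x" if "x \<in> carrier K" for x
    using e that by (simp add: q_def)
  have "q \<in> hom E G"
    unfolding q_def using K.iso_set_sym[OF ei] p by (auto simp: iso_def intro: hom_compose)
  then interpret q: group_hom E G q
    using E \<open>group G\<close> by (simp add: group_hom_def group_hom_axioms_def)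
  define T where "T = kernel E G q"
  have T: "T = e ` kernel K G p"
    by (auto simp: T_def kernel_def carE qe)
  have "q ` carrier E = carrier G"
    using surj by (simp add: carE image_image qe)
  then have "group_extension E T G"
    unfolding group_extension_def T_def
    using E q.normal_kernel q.FactGroup_iso by simp
  moreover have "inj_on e (kernel K G p)"
    using e by (rule inj_on_subset) (auto simp: kernel_def)
  then have "card T = 2 ^ n"
    using card by (simp add: T card_image)
  then have "two_group (E\<lparr>carrier := T\<rparr>)"
    unfolding two_group_def order_def T_def
    using q.subgroup_kernel E subgroup.subgroup_is_group by auto
  moreover have "involutions E \<subseteq> T"
  proof
    fix y assume "y \<in> involutions E"
    then have y: "y \<in> carrier E" and yy: "y \<otimes>\<^bsub>E\<^esub> y = \<one>\<^bsub>E\<^esub>"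
      using q.G.ord_eq_2_iff by (auto simp: involutions_def)
    from y obtain x where x: "x \<in> carrier K" "y = e x" by (auto simp: carE)
    have "e (x \<otimes>\<^bsub>K\<^esub> x) = e \<one>\<^bsub>K\<^esub>"
      using yy x e by (simp add: E_def image_group_def)
    then have "x \<otimes>\<^bsub>K\<^esub> x = \<one>\<^bsub>K\<^esub>"
      using e x by (auto dest: inj_onD)
    then show "y \<in> T" using x y inv qe by (simp add: T_def kernel_def)
  qed
  ultimately show ?thesis by blast
qed

section \<open>The group of lifts\<close>

text \<open>Functions into \<open>\<int>/2\<close> are encoded as subsets of the carrier, addition as \<open>\<noteq>\<close> of
  membership statements.\<close>

definition lift_group :: "('a, 'm) monoid_scheme \<Rightarrow> 'a \<Rightarrow> 'a set \<Rightarrow> ('a \<times> 'a set) monoid" where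
  "lift_group G h S = \<lparr>
     carrier = {(g, A). g \<in> carrier G \<and> A \<subseteq> carrier G \<and>
       (\<forall>x\<in>carrier G. ((x \<in> A) \<noteq> (x \<otimes>\<^bsub>G\<^esub> h \<in> A)) = ((x \<in> S) \<noteq> (g \<otimes>\<^bsub>G\<^esub> x \<in> S)))},
     monoid.mult = \<lambda>(g, A) (g', A').
       (g \<otimes>\<^bsub>G\<^esub> g', {x \<in> carrier G. (g' \<otimes>\<^bsub>G\<^esub> x \<in> A) \<noteq> (x \<in> A')}),
     monoid.one = (\<one>\<^bsub>G\<^esub>, {})\<rparr>"

text \<open>Within the carrier, \<open>S_shift\<close> makes \<open>S\<close> meet each coset
  \<open>x<h>\<close> in exactly one point, which forces \<open>h\<close> to be nontrivial. Points
  of \<open>S\<close> outside the carrier are unrestricted, hence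
  \<open>S \<inter> carrier G\<close> in the count below.\<close>

locale half_transversal = group G for G :: "('a, 'm) monoid_scheme" (structure) +
  fixes h :: 'a and S :: "'a set"
  assumes h_closed [simp]: "h \<in> carrier G"
    and h_sq: "h \<otimes> h = \<one>"
    and S_shift: "x \<in> carrier G \<Longrightarrow> x \<otimes> h \<in> S \<longleftrightarrow> x \<notin> S"
begin

lemma shift_shift [simp]: "x \<in> carrier G \<Longrightarrow> x \<otimes> h \<otimes> h = x"
  by (simp add: m_assoc h_sq)

lemma carrier_lift:
  "(g, A) \<in> carrier (lift_group G h S) \<longleftrightarrow> g \<in> carrier G \<and> A \<subseteq> carrier G \<and>
     (\<forall>x\<in>carrier G. ((x \<in> A) \<noteq> (x \<otimes> h \<in> A)) = ((x \<in> S) \<noteq> (g \<otimes> x \<in> S)))"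
  by (simp add: lift_group_def)

lemma mult_lift:
  "(g, A) \<otimes>\<^bsub>lift_group G h S\<^esub> (g', A') =
     (g \<otimes> g', {x \<in> carrier G. (g' \<otimes> x \<in> A) \<noteq> (x \<in> A')})"
  by (simp add: lift_group_def)

lemma one_lift: "\<one>\<^bsub>lift_group G h S\<^esub> = (\<one>, {})"
  by (simp add: lift_group_def)

lemma group_lift: "group (lift_group G h S)" (is "group ?K")
proof (rule groupI)
  fix x y assume "x \<in> carrier ?K" "y \<in> carrier ?K"
  moreover obtain g A g' A' where "x = (g, A)" "y = (g', A')" by (cases x, cases y)
  ultimately have x: "x = (g, A)" "y = (g', A')" "g \<in> carrier G" "g' \<in> carrier G"
    and A: "\<And>z. z \<in> carrier G \<Longrightarrow> ((z \<in> A) \<noteq> (z \<otimes> h \<in> A)) = ((z \<in> S) \<noteq> (g \<otimes> z \<in> S))"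
    and A': "\<And>z. z \<in> carrier G \<Longrightarrow> ((z \<in> A') \<noteq> (z \<otimes> h \<in> A')) = ((z \<in> S) \<noteq> (g' \<otimes> z \<in> S))"
    by (auto simp: carrier_lift)
  \<comment> \<open>Add the condition on \<open>A\<close> at \<open>g' \<otimes> z\<close> to the
    condition on \<open>A'\<close> at \<open>z\<close>: the two terms
    \<open>g' \<otimes> z \<in> S\<close> cancel.\<close>
  have "(((g' \<otimes> z \<in> A) \<noteq> (z \<in> A')) \<noteq> ((g' \<otimes> (z \<otimes> h) \<in> A) \<noteq> (z \<otimes> h \<in> A'))) =
      ((z \<in> S) \<noteq> (g \<otimes> g' \<otimes> z \<in> S))" if "z \<in> carrier G" for z
    using A[of "g' \<otimes> z"] A'[OF that] x that by (simp add: m_assoc) argo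
  then show "x \<otimes>\<^bsub>?K\<^esub> y \<in> carrier ?K"
    using x by (auto simp: mult_lift carrier_lift)
next
  show "\<one>\<^bsub>?K\<^esub> \<in> carrier ?K" by (simp add: one_lift carrier_lift)
next
  fix x y z assume "x \<in> carrier ?K" "y \<in> carrier ?K" "z \<in> carrier ?K"
  then show "x \<otimes>\<^bsub>?K\<^esub> y \<otimes>\<^bsub>?K\<^esub> z = x \<otimes>\<^bsub>?K\<^esub> (y \<otimes>\<^bsub>?K\<^esub> z)"
    by (cases x, cases y, cases z) (auto simp: mult_lift carrier_lift m_assoc)
next
  fix x assume "x \<in> carrier ?K"
  then show "\<one>\<^bsub>?K\<^esub> \<otimes>\<^bsub>?K\<^esub> x = x"
    by (cases x) (auto simp: mult_lift carrier_lift one_lift)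
next
  fix x assume "x \<in> carrier ?K"
  moreover obtain g A where "x = (g, A)" by (cases x)
  ultimately have x: "x = (g, A)" "g \<in> carrier G" "A \<subseteq> carrier G"
    and A: "\<And>z. z \<in> carrier G \<Longrightarrow> ((z \<in> A) \<noteq> (z \<otimes> h \<in> A)) = ((z \<in> S) \<noteq> (g \<otimes> z \<in> S))"
    by (auto simp: carrier_lift)
  \<comment> \<open>The inverse permutation sends \<open>(x, a)\<close> to
    \<open>(inv g \<otimes> x, a - f(inv g \<otimes> x))\<close>, with \<open>f\<close> the
    indicator of \<open>A\<close>; modulo 2 the sign disappears.\<close>
  let ?y = "(inv g, {z \<in> carrier G. inv g \<otimes> z \<in> A})"
  have "((inv g \<otimes> z \<in> A) \<noteq> (inv g \<otimes> (z \<otimes> h) \<in> A)) = ((z \<in> S) \<noteq> (inv g \<otimes> z \<in> S))"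
    if "z \<in> carrier G" for z
  proof -
    have "g \<otimes> (inv g \<otimes> z) = z" using x that by (simp flip: m_assoc)
    then show ?thesis using A[of "inv g \<otimes> z"] x that by (simp add: m_assoc) argo
  qed
  then have "?y \<in> carrier ?K" using x by (simp add: carrier_lift)
  moreover have "?y \<otimes>\<^bsub>?K\<^esub> x = \<one>\<^bsub>?K\<^esub>"
  proof -
    have "inv g \<otimes> (g \<otimes> z) = z" if "z \<in> carrier G" for z
      using x that by (simp flip: m_assoc)
    then show ?thesis using x by (auto simp: mult_lift one_lift)
  qed
  ultimately show "\<exists>y\<in>carrier ?K. y \<otimes>\<^bsub>?K\<^esub> x = \<one>\<^bsub>?K\<^esub>" by blast
qed

lemma fst_hom: "fst \<in> hom (lift_group G h S) G"
  by (auto simp: hom_def carrier_lift mult_lift)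

lemma fst_surj: "fst ` carrier (lift_group G h S) = carrier G"
proof
  show "carrier G \<subseteq> fst ` carrier (lift_group G h S)"
  proof
    fix g assume g: "g \<in> carrier G"
    \<comment> \<open>The required sum \<open>s(x) + s(gx)\<close> is unchanged under
      \<open>x \<mapsto> xh\<close>, because both terms flip. So \<open>f\<close> can take this
      value at the point of each coset that lies in \<open>S\<close> and 0 at the other
      point.\<close>
    let ?A = "{x \<in> carrier G. x \<in> S \<and> g \<otimes> x \<notin> S}"
    have "g \<otimes> (x \<otimes> h) \<in> S \<longleftrightarrow> g \<otimes> x \<notin> S" if "x \<in> carrier G" for x
      using S_shift[of "g \<otimes> x"] g that by (simp add: m_assoc)
    then have "(g, ?A) \<in> carrier (lift_group G h S)"
      using g by (auto simp: carrier_lift S_shift)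
    then show "g \<in> fst ` carrier (lift_group G h S)" by force
  qed
qed (auto simp: carrier_lift)

text \<open>For \<open>g = \<one>\<close> the right side of the commutation condition vanishes,
  which leaves the functions constant on the cosets \<open>x<h>\<close>, that is, the coinduced
  module.\<close>

lemma kernel_fst:
  "kernel (lift_group G h S) G fst =
     Pair \<one> ` {A. A \<subseteq> carrier G \<and> (\<forall>x\<in>carrier G. x \<otimes> h \<in> A \<longleftrightarrow> x \<in> A)}"
proof -
  have "(\<forall>x\<in>carrier G. ((x \<in> A) \<noteq> (x \<otimes> h \<in> A)) = ((x \<in> S) \<noteq> (\<one> \<otimes> x \<in> S))) \<longleftrightarrow>
      (\<forall>x\<in>carrier G. x \<otimes> h \<in> A \<longleftrightarrow> x \<in> A)" for A
    by (rule ball_cong[OF refl]) (simp, argo)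
  then have "(g, A) \<in> kernel (lift_group G h S) G fst \<longleftrightarrow>
      g = \<one> \<and> A \<in> {A. A \<subseteq> carrier G \<and> (\<forall>x\<in>carrier G. x \<otimes> h \<in> A \<longleftrightarrow> x \<in> A)}" for g A
    by (cases "g = \<one>")
      (simp_all only: kernel_def mem_Collect_eq carrier_lift fst_conv one_closed simp_thms)
  moreover have "(g, A) \<in> Pair \<one> ` F \<longleftrightarrow> g = \<one> \<and> A \<in> F" for g A and F :: "'a set set"
    by blast
  ultimately show ?thesis by (simp only: set_eq_iff split_paired_All simp_thms)
qed

text \<open>A union of cosets \<open>x<h>\<close> is determined by its trace on the transversal, and
  every subset of the transversal is such a trace.\<close>

lemma card_kernel_fst:
  assumes "finite (carrier G)"
  shows "card (kernel (lift_group G h S) G fst) = 2 ^ card (S \<inter> carrier G)"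
proof -
  let ?F = "{A. A \<subseteq> carrier G \<and> (\<forall>x\<in>carrier G. x \<otimes> h \<in> A \<longleftrightarrow> x \<in> A)}"
  have "bij_betw (\<lambda>A. A \<inter> S) ?F (Pow (S \<inter> carrier G))"
  proof (rule bij_betwI[where g = "\<lambda>B. {x \<in> carrier G. x \<in> B \<or> x \<otimes> h \<in> B}"])
    fix A assume "A \<in> ?F"
    then have "A \<subseteq> carrier G" and "\<And>x. x \<in> carrier G \<Longrightarrow> x \<otimes> h \<in> A \<longleftrightarrow> x \<in> A"
      by blast+
    then show "{x \<in> carrier G. x \<in> A \<inter> S \<or> x \<otimes> h \<in> A \<inter> S} = A"
      using S_shift by blast
  next
    fix B assume "B \<in> Pow (S \<inter> carrier G)"
    then show "{x \<in> carrier G. x \<in> B \<or> x \<otimes> h \<in> B} \<inter> S = B"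
      using S_shift by blast
  qed auto
  then have "card ?F = 2 ^ card (S \<inter> carrier G)"
    using assms by (simp add: bij_betw_same_card card_Pow del: Pow_Int_eq)
  then show ?thesis by (simp add: kernel_fst card_image inj_on_def)
qed

lemma finite_lift: "finite (carrier G) \<Longrightarrow> finite (carrier (lift_group G h S))"
  by (rule finite_subset[of _ "carrier G \<times> Pow (carrier G)"]) (auto simp: carrier_lift)

lemma lift_sq_eq_one:
  assumes conj: "\<And>g. g \<in> involutions G \<Longrightarrow> \<exists>k\<in>carrier G. g = k \<otimes> h \<otimes> inv k"
    and "x \<in> carrier (lift_group G h S)"
    and "x \<otimes>\<^bsub>lift_group G h S\<^esub> x = \<one>\<^bsub>lift_group G h S\<^esub>"
  shows "fst x = \<one>"
proof (rule ccontr)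
  assume ne: "fst x \<noteq> \<one>"
  obtain g A where x: "x = (g, A)" by (cases x)
  from assms have g: "g \<in> carrier G" "g \<otimes> g = \<one>"
    and A: "\<And>z. z \<in> carrier G \<Longrightarrow> ((z \<in> A) \<noteq> (z \<otimes> h \<in> A)) = ((z \<in> S) \<noteq> (g \<otimes> z \<in> S))"
    and AA: "\<And>z. z \<in> carrier G \<Longrightarrow> g \<otimes> z \<in> A \<longleftrightarrow> z \<in> A"
    by (auto simp: x carrier_lift mult_lift one_lift)
  have "g \<in> involutions G" using g ne x by (simp add: involutions_def ord_eq_2_iff)
  then obtain k where k: "k \<in> carrier G" "g = k \<otimes> h \<otimes> inv k" using conj by blast
  then have "g \<otimes> k = k \<otimes> h" by (simp add: m_assoc)
  \<comment> \<open>At \<open>k\<close>, \<open>AA\<close> gives \<open>f(gk) = f(k)\<close>, while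
    \<open>A\<close> together with \<open>gk = kh\<close> gives
    \<open>f(k) + f(gk) = 1\<close>.\<close>
  then show False using A[of k] AA[of k] S_shift[of k] k by simp
qed

end

section \<open>Choice of a transversal and conclusion\<close>

lemma (in group) half_transversal_exists:
  assumes "finite (carrier G)" and h: "h \<in> carrier G" "h \<otimes> h = \<one>" "h \<noteq> \<one>"
  obtains S where "half_transversal G h S"
proof -
  obtain e :: "'a \<Rightarrow> nat" where e: "inj_on e (carrier G)"
    using finite_imp_inj_to_nat_seg[OF assms(1)] by blast
  \<comment> \<open>From each pair \<open>x\<close>, \<open>xh\<close> of distinct elements, take
    the one with the smaller number.\<close>
  have "half_transversal G h {x. e x < e (x \<otimes> h)}"
  proof unfold_locales
    fix x assume x: "x \<in> carrier G"
    have "x \<otimes> h \<noteq> x" using h x by simp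
    then have "e (x \<otimes> h) \<noteq> e x" using e h x by (auto dest: inj_onD)
    moreover have "x \<otimes> h \<otimes> h = x" using h x by (simp add: m_assoc)
    ultimately show "x \<otimes> h \<in> {x. e x < e (x \<otimes> h)} \<longleftrightarrow> x \<notin> {x. e x < e (x \<otimes> h)}"
      by auto
  qed (use h in auto)
  then show ?thesis by (rule that)
qed

theorem proposition2:
  fixes G :: "('a, 'm) monoid_scheme" and H :: "'a set"
  assumes "group G"
    and "finite (carrier G)"
    and "unique_involution_class G"
    and "subgroup H G"
    and "card H = 2"
  shows "\<exists>(E :: nat monoid) T.
           group_extension E T G
         \<and> two_group (E\<lparr>carrier := T\<rparr>)
         \<and> involutions E \<subseteq> T"
proof -
  interpret group G by fact
  note ex1 = assms(3)[unfolded unique_involution_class_def]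
  obtain h where hi: "h \<in> involutions G"
    using ex1_implies_ex[OF ex1] by (elim exE bexE)
  have cls: "conjugacy_class G g = conjugacy_class G h" if "g \<in> involutions G" for g
    using ex1[unfolded ex1_iff_ex_Uniq, THEN conjunct2]
    by (rule Uniq_D) (rule bexI[OF refl that] bexI[OF refl hi])+
  have h: "h \<in> carrier G" "h \<otimes>\<^bsub>G\<^esub> h = \<one>\<^bsub>G\<^esub>" "h \<noteq> \<one>\<^bsub>G\<^esub>"
    using hi ord_eq_2_iff by (auto simp: involutions_def)
  \<comment> \<open>Each involution lies in its own class, which is the class of \<open>h\<close>.
    Hence one transversal for \<open><h>\<close> excludes square roots of 1 above every involution
    of \<open>G\<close>.\<close>
  have conj: "\<exists>k\<in>carrier G. g = k \<otimes>\<^bsub>G\<^esub> h \<otimes>\<^bsub>G\<^esub> inv\<^bsub>G\<^esub> k" if "g \<in> involutions G" for g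
  proof -
    have "g \<in> carrier G" using that by (simp add: involutions_def)
    then have "g = \<one>\<^bsub>G\<^esub> \<otimes>\<^bsub>G\<^esub> g \<otimes>\<^bsub>G\<^esub> inv\<^bsub>G\<^esub> \<one>\<^bsub>G\<^esub>" by simp
    then have "g \<in> conjugacy_class G g" unfolding conjugacy_class_def by blast
    then show ?thesis using cls[OF that] by (auto simp: conjugacy_class_def)
  qed
  obtain S where "half_transversal G h S"
    using half_transversal_exists[OF assms(2) h] .
  then interpret half_transversal G h S .
  show ?thesis
  proof (rule extension_on_nat[OF assms(1) group_lift])
    show "finite (carrier (lift_group G h S))" using assms(2) by (rule finite_lift)
    show "card (kernel (lift_group G h S) G fst) = 2 ^ card (S \<inter> carrier G)"
      using assms(2) by (rule card_kernel_fst)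
    show "fst x = \<one>\<^bsub>G\<^esub>" if "x \<in> carrier (lift_group G h S)"
      "x \<otimes>\<^bsub>lift_group G h S\<^esub> x = \<one>\<^bsub>lift_group G h S\<^esub>" for x
      using conj that by (rule lift_sq_eq_one)
  qed (rule fst_hom fst_surj)+
qed

end
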